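(* Assume the Axiom of Choice. Let $X$ be a completely regular $T_1$ space. Then $\mathscr P(\beta X)\cong\beta\,\mathscr P(X)$ as MT-algebras, where $\beta X$ is the Stone–Čech extension of $X$ and $\beta\,\mathscr P(X)$ is the Stone–Čech extension of the MT-algebra $\mathscr P(X)$. Consequently, $\beta X$ is homeomorphic to $\mathrm{at}(\beta\,\mathscr P(X))$.
   Context: MT-algebras. An MT-algebra is a pair $(M,\square)$, where $M$ is a complete Boolean algebra and $\square:M\to M$ satisfies $\square 1=1$, $\square(a\wedge b)=\square a\wedge\square b$, $\square a\le a$, $\square a\le\square\square a$. Put $\Diamond a=\neg\square\neg a$. An element $a$ is open if $a=\square a$ and closed if $a=\Diamond a$; $\mathcal O(M)$ and $\mathcal C(M)$ are the sets of open and closed elements. An MT-morphism $h:N\to M$ is a complete Boolean homomorphism with $h(\square a)\le\square h(a)$ for all $a$; isomorphisms are the invertible MT-morphisms (Boolean isomorphisms commuting with $\square$). For a topological space $X$, $\mathscr P(X)$ is the MT-algebra given by the powerset of $X$ with the topological interior operator. For an MT-algebra $M$, $\mathrm{at}(M)$ is the set of atoms of $M$ with the topology whose open sets are $\{x\in\mathrm{at}(M)\mid x\le u\}$ for $u\in\mathcal O(M)$. Zero-elements. Write $a\prec b$ if $\Diamond a\le\square b$, and $a\prec\!\prec b$ if there is a family $\{c_p\mid p\in[0,1]\cap\mathbb Q\}\subseteq M$ with $a\le c_0$, $c_1\le b$, and $c_p\prec c_q$ whenever $p<q$. An element $a\in M$ is a zero-element if there is a sequence $(c_n)_{n\in\mathbb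 N}$ in $\mathcal C(M)$ with $a=\bigwedge_n c_n$ and $c_{n+1}\prec\!\prec c_n$ for all $n$. $\mathcal Z(M)$ is the set of zero-elements, a bounded sublattice of $\mathcal C(M)$. Stone–Čech extension of a space. For $X$ completely regular, $\beta X$ is the set of maximal proper filters of the lattice $\mathcal Z(\mathscr P(X))$, with the topology having the sets $\{F\in\beta X\mid Z\in F\}$, $Z\in\mathcal Z(\mathscr P(X))$, as a closed base. Stone–Čech extension of an MT-algebra. For a completely regular MT-algebra $M$ (i.e. $M$ is join-generated by its closed elements and $u=\bigvee\{v\in\mathcal O(M)\mid v\prec\!\prec u\}$ for each $u\in\mathcal O(M)$) put $\mathcal B=\mathcal Z(M)$ and $\beta M=\mathbf{RO}(X_{\mathcal B})$. Here $X_{\mathcal B}$ is the set of proper filters of $\mathcal B$ ordered by inclusion and given the topology of upsets; $\mathbf{RO}(X_{\mathcal B})$ is the complete Boolean algebra of its regular open sets, i.e. upsets $U$ with $U=\{x\mid \mathord{\uparrow}x\subseteq\mathord{\downarrow}U\}$. For $a\in M$, $$\sigma_{\mathcal B}(a)=\{x\in X_{\mathcal B}\mid \text{for all } y\in X_{\mathcal B}\text{ with }x\subseteq y\text{ and all }b\in y,\ a\wedge b\ne0\}\in\mathbf{RO}(X_{\mathcal B}).$$ $\mathbf{RO}(X_{\mathcal B})$ is made an MT-algebra by declaring its closed elements to be the arbitrary meets of elements of $\{\sigma_{\mathcal B}(b)\mid b\in\mathcal B\}$ (the open elements are the complements of closed ones, and $\square A$ is the largest open element below $A$). *)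

theory Defs
  imports "HOL-Analysis.Analysis" "HOL-Algebra.Complete_Lattice"
begin

section \<open>MT-algebras\<close>

text \<open>Orders, joins and meets are those of HOL-Algebra, relative to a carrier set; the field
  \<open>eq\<close> inherited from \<^typ>\<open>'a gorder\<close> is always instantiated with equality.\<close>

record 'a mt = "'a gorder" +
  mt_box :: "'a \<Rightarrow> 'a"

definition bcompl :: "('a, 'b) gorder_scheme \<Rightarrow> 'a \<Rightarrow> 'a" where
  "bcompl L a = (THE b. b \<in> carrier L \<and> a \<sqinter>\<^bsub>L\<^esub> b = \<bottom>\<^bsub>L\<^esub> \<and> a \<squnion>\<^bsub>L\<^esub> b = \<top>\<^bsub>L\<^esub>)"

text \<open>The one-element algebra is not excluded; it is the powerset algebra of the empty space.\<close>

locale complete_boolean_lattice = Complete_Lattice.complete_lattice L for L (structure) +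
  assumes meet_join_distrib:
    "\<lbrakk>x \<in> carrier L; y \<in> carrier L; z \<in> carrier L\<rbrakk>
      \<Longrightarrow> x \<sqinter> (y \<squnion> z) = (x \<sqinter> y) \<squnion> (x \<sqinter> z)"
    and complement_exists:
    "x \<in> carrier L \<Longrightarrow> \<exists>y \<in> carrier L. x \<sqinter> y = \<bottom> \<and> x \<squnion> y = \<top>"

locale mt_algebra = complete_boolean_lattice M for M :: "('a, 'b) mt_scheme" (structure) +
  assumes box_closed: "a \<in> carrier M \<Longrightarrow> mt_box M a \<in> carrier M"
    and box_top: "mt_box M \<top> = \<top>"
    and box_meet: "\<lbrakk>a \<in> carrier M; b \<in> carrier M\<rbrakk>
      \<Longrightarrow> mt_box M (a \<sqinter> b) = mt_box M a \<sqinter> mt_box M b"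
    and box_le: "a \<in> carrier M \<Longrightarrow> mt_box M a \<sqsubseteq> a"
    and box_box: "a \<in> carrier M \<Longrightarrow> mt_box M a \<sqsubseteq> mt_box M (mt_box M a)"

definition mt_diamond :: "('a, 'b) mt_scheme \<Rightarrow> 'a \<Rightarrow> 'a" where
  "mt_diamond M a = bcompl M (mt_box M (bcompl M a))"

definition mt_opens :: "('a, 'b) mt_scheme \<Rightarrow> 'a set" where
  "mt_opens M = {a \<in> carrier M. a = mt_box M a}"

definition mt_closeds :: "('a, 'b) mt_scheme \<Rightarrow> 'a set" where
  "mt_closeds M = {a \<in> carrier M. a = mt_diamond M a}"

definition complete_boolean_hom ::
  "('a, 'c) gorder_scheme \<Rightarrow> ('b, 'd) gorder_scheme \<Rightarrow> ('a \<Rightarrow> 'b) \<Rightarrow> bool" where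
  "complete_boolean_hom N M h \<longleftrightarrow>
     h \<in> carrier N \<rightarrow> carrier M \<and>
     (\<forall>A. A \<subseteq> carrier N \<longrightarrow> h (\<Squnion>\<^bsub>N\<^esub>A) = \<Squnion>\<^bsub>M\<^esub>(h ` A)) \<and>
     (\<forall>A. A \<subseteq> carrier N \<longrightarrow> h (\<Sqinter>\<^bsub>N\<^esub>A) = \<Sqinter>\<^bsub>M\<^esub>(h ` A)) \<and>
     (\<forall>a \<in> carrier N. h (bcompl N a) = bcompl M (h a))"

definition mt_morphism ::
  "('a, 'c) mt_scheme \<Rightarrow> ('b, 'd) mt_scheme \<Rightarrow> ('a \<Rightarrow> 'b) \<Rightarrow> bool" where
  "mt_morphism N M h \<longleftrightarrow>
     mt_algebra N \<and> mt_algebra M \<and> complete_boolean_hom N M h \<and>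
     (\<forall>a \<in> carrier N. h (mt_box N a) \<sqsubseteq>\<^bsub>M\<^esub> mt_box M (h a))"

definition mt_isomorphic :: "('a, 'c) mt_scheme \<Rightarrow> ('b, 'd) mt_scheme \<Rightarrow> bool"
    (infix \<open>\<cong>\<^sub>M\<^sub>T\<close> 50) where
  "N \<cong>\<^sub>M\<^sub>T M \<longleftrightarrow>
     (\<exists>h g. mt_morphism N M h \<and> mt_morphism M N g \<and>
        (\<forall>a \<in> carrier N. g (h a) = a) \<and> (\<forall>b \<in> carrier M. h (g b) = b))"

definition powerset_mt :: "'a topology \<Rightarrow> 'a set mt" where
  "powerset_mt X =
     \<lparr>carrier = Pow (topspace X), eq = (=), le = (\<subseteq>), mt_box = (\<lambda>A. X interior_of A)\<rparr>"

definition mt_atoms :: "('a, 'b) mt_scheme \<Rightarrow> 'a set" where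
  "mt_atoms M = {x \<in> carrier M. x \<noteq> \<bottom>\<^bsub>M\<^esub> \<and>
     (\<forall>y \<in> carrier M. y \<sqsubseteq>\<^bsub>M\<^esub> x \<longrightarrow> y = \<bottom>\<^bsub>M\<^esub> \<or> y = x)}"

definition atom_space :: "('a, 'b) mt_scheme \<Rightarrow> 'a topology" where
  "atom_space M = topology (\<lambda>U. \<exists>u \<in> mt_opens M. U = {x \<in> mt_atoms M. x \<sqsubseteq>\<^bsub>M\<^esub> u})"


section \<open>Zero-elements\<close>

definition mt_prec :: "('a, 'b) mt_scheme \<Rightarrow> 'a \<Rightarrow> 'a \<Rightarrow> bool" where
  "mt_prec M a b \<longleftrightarrow> mt_diamond M a \<sqsubseteq>\<^bsub>M\<^esub> mt_box M b"

definition mt_precprec :: "('a, 'b) mt_scheme \<Rightarrow> 'a \<Rightarrow> 'a \<Rightarrow> bool" where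
  "mt_precprec M a b \<longleftrightarrow>
     (\<exists>c :: rat \<Rightarrow> 'a. (\<forall>p \<in> {0..1}. c p \<in> carrier M) \<and>
        a \<sqsubseteq>\<^bsub>M\<^esub> c 0 \<and> c 1 \<sqsubseteq>\<^bsub>M\<^esub> b \<and>
        (\<forall>p \<in> {0..1}. \<forall>q \<in> {0..1}. p < q \<longrightarrow> mt_prec M (c p) (c q)))"

definition zero_elements :: "('a, 'b) mt_scheme \<Rightarrow> 'a set" where
  "zero_elements M = {a. \<exists>c :: nat \<Rightarrow> 'a. (\<forall>n. c n \<in> mt_closeds M) \<and>
     a = \<Sqinter>\<^bsub>M\<^esub>(range c) \<and> (\<forall>n. mt_precprec M (c (Suc n)) (c n))}"


section \<open>Proper filters of a bounded sublattice\<close>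

definition proper_filters :: "('a, 'b) gorder_scheme \<Rightarrow> 'a set \<Rightarrow> 'a set set" where
  "proper_filters L B = {F. F \<subseteq> B \<and> F \<noteq> {} \<and> F \<noteq> B \<and>
     (\<forall>a \<in> F. \<forall>b \<in> B. a \<sqsubseteq>\<^bsub>L\<^esub> b \<longrightarrow> b \<in> F) \<and>
     (\<forall>a \<in> F. \<forall>b \<in> F. a \<sqinter>\<^bsub>L\<^esub> b \<in> F)}"

definition maximal_filters :: "('a, 'b) gorder_scheme \<Rightarrow> 'a set \<Rightarrow> 'a set set" where
  "maximal_filters L B =
     {F \<in> proper_filters L B. \<forall>G \<in> proper_filters L B. F \<subseteq> G \<longrightarrow> G = F}"


section \<open>The Stone-Cech extension of a space\<close>

abbreviation stone_cech_points :: "'a topology \<Rightarrow> 'a set set set" where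
  "stone_cech_points X \<equiv>
     maximal_filters (powerset_mt X) (zero_elements (powerset_mt X))"

text \<open>A family is a closed base if the complements of its members form a base of open sets.\<close>

definition stone_cech :: "'a topology \<Rightarrow> 'a set set topology" where
  "stone_cech X = topology (arbitrary union_of
     (\<lambda>U. \<exists>Z \<in> zero_elements (powerset_mt X).
        U = stone_cech_points X - {F \<in> stone_cech_points X. Z \<in> F}))"


section \<open>The Stone-Cech extension of an MT-algebra\<close>

text \<open>Regular open sets of the poset of proper filters, in the topology of upsets.\<close>

definition regular_opens :: "('a, 'b) gorder_scheme \<Rightarrow> 'a set \<Rightarrow> 'a set set gorder" where
  "regular_opens L B =
     (let P = proper_filters L B in
      \<lparr>carrier = {U. U \<subseteq> P \<and> (\<forall>x \<in> U. \<forall>y \<in> P. x \<subseteq> y \<longrightarrow> y \<in> U) \<and>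
                   U = {x \<in> P. {y \<in> P. x \<subseteq> y} \<subseteq> {y \<in> P. \<exists>z \<in> U. y \<subseteq> z}}},
       eq = (=), le = (\<subseteq>)\<rparr>)"

definition filter_sigma :: "('a, 'b) gorder_scheme \<Rightarrow> 'a set \<Rightarrow> 'a \<Rightarrow> 'a set set" where
  "filter_sigma L B a = {x \<in> proper_filters L B.
     \<forall>y \<in> proper_filters L B. x \<subseteq> y \<longrightarrow> (\<forall>b \<in> y. a \<sqinter>\<^bsub>L\<^esub> b \<noteq> \<bottom>\<^bsub>L\<^esub>)}"

definition ro_closeds :: "('a, 'b) gorder_scheme \<Rightarrow> 'a set \<Rightarrow> 'a set set set" where
  "ro_closeds L B = {\<Sqinter>\<^bsub>regular_opens L B\<^esub>(filter_sigma L B ` S) |S. S \<subseteq> B}"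

definition ro_opens :: "('a, 'b) gorder_scheme \<Rightarrow> 'a set \<Rightarrow> 'a set set set" where
  "ro_opens L B = bcompl (regular_opens L B) ` ro_closeds L B"

text \<open>The open elements are closed under arbitrary joins, so the join of those below \<open>A\<close> is the
  largest open element below \<open>A\<close>.\<close>

definition ro_mt :: "('a, 'b) gorder_scheme \<Rightarrow> 'a set \<Rightarrow> 'a set set mt" where
  "ro_mt L B = gorder.extend (regular_opens L B)
     (mt.fields (\<lambda>A. \<Squnion>\<^bsub>regular_opens L B\<^esub>{U \<in> ro_opens L B. U \<subseteq> A}))"

text \<open>Intended for completely regular \<open>M\<close>.\<close>

definition mt_beta :: "('a, 'b) mt_scheme \<Rightarrow> 'a set set mt" where
  "mt_beta M = ro_mt M (zero_elements M)"

end

theory Submission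
  imports Defs
begin

text \<open>
  By Zorn's lemma every proper filter of the lattice of zero-elements extends to a maximal one, so a
  regular open set of proper filters is determined by the maximal filters it contains, and every set
  of maximal filters arises in this way. Hence the regular opens form a copy of the powerset of
  the Stone-Cech extension. Under this correspondence the regular open set attached to a zero-element
  \<open>b\<close> becomes the basic closed set of maximal filters containing \<open>b\<close>: a maximal
  filter contains \<open>b\<close> as soon as each of its members meets \<open>b\<close>. So closed
  elements correspond to closed sets, and interiors to interiors. The atoms of the algebra are then
  the images of the singletons.
\<close>

section \<open>Transport of a topology along an injective map\<close>

lemma homeomorphic_space_image_topology:
  assumes inj: "inj_on f (topspace Y)"
  shows "Y homeomorphic_space topology (\<lambda>W. \<exists>U. openin Y U \<and> W = f ` U)"
proof -
  define T where "T = topology (\<lambda>W. \<exists>U. openin Y U \<and> W = f ` U)"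
  \<comment> \<open>\<open>topology\<close> returns the intended open sets only for a predicate that
    satisfies \<open>istopology\<close>. Injectivity enters for intersections, since images commute
    with them only then.\<close>
  have "istopology (\<lambda>W. \<exists>U. openin Y U \<and> W = f ` U)"
    unfolding istopology_def
  proof (intro conjI allI impI)
    fix \<K> assume \<K>: "\<forall>K\<in>\<K>. \<exists>U. openin Y U \<and> K = f ` U"
    \<comment> \<open>Collecting every open set whose image lies in \<open>\<K>\<close> avoids
      choosing one preimage for each member.\<close>
    have "\<Union>\<K> = f ` \<Union>{U. openin Y U \<and> f ` U \<in> \<K>}"
    proof
      show "\<Union>\<K> \<subseteq> f ` \<Union>{U. openin Y U \<and> f ` U \<in> \<K>}"
        using \<K> by fast
    qed blast
    moreover have "openin Y (\<Union>{U. openin Y U \<and> f ` U \<in> \<K>})"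
      by (rule openin_Union) simp
    ultimately show "\<exists>U. openin Y U \<and> \<Union>\<K> = f ` U"
      by blast
  next
    fix V W assume "\<exists>U. openin Y U \<and> V = f ` U" "\<exists>U. openin Y U \<and> W = f ` U"
    then obtain U U' where "openin Y U" "V = f ` U" "openin Y U'" "W = f ` U'"
      by blast
    then show "\<exists>U. openin Y U \<and> V \<inter> W = f ` U"
      using inj by (intro exI[of _ "U \<inter> U'"]) (simp add: inj_on_image_Int openin_subset openin_Int)
  qed
  then have openin_T: "openin T W \<longleftrightarrow> (\<exists>U. openin Y U \<and> W = f ` U)" for W
    by (simp add: T_def topology_inverse')
  have topspace_T: "topspace T = f ` topspace Y"
  proof
    have "openin T (f ` topspace Y)"
      using openin_T by blast
    then show "f ` topspace Y \<subseteq> topspace T"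
      by (rule openin_subset)
    show "topspace T \<subseteq> f ` topspace Y"
      using openin_topspace[of T] openin_T openin_subset by (metis image_mono)
  qed
  have "{y \<in> topspace Y. f y \<in> f ` U} = U" if "openin Y U" for U
    using openin_subset[OF that] inj by (auto simp: inj_on_def)
  then have "continuous_map Y T f"
    using openin_T by (auto simp: continuous_map_def topspace_T)
  moreover have "open_map Y T f"
    using openin_T by (auto simp: open_map_def)
  ultimately have "homeomorphic_map Y T f"
    using topspace_T inj by (intro bijective_open_imp_homeomorphic_map) simp_all
  then show ?thesis
    unfolding T_def by (rule homeomorphic_map_imp_homeomorphic_space)
qed

section \<open>Algebras represented as powersets\<close>

text \<open>The assumptions make \<open>h\<close> an order isomorphism from the powerset of
  \<open>S\<close>. Completeness, the Boolean laws and all lattice operations of \<open>L\<close>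
  are then derived by computing with sets. The last assumption is there because orders in
  HOL-Algebra carry their own equality.\<close>

locale powerset_representation =
  fixes L :: "('b, 'c) gorder_scheme" (structure) and S :: "'a set" and h :: "'a set \<Rightarrow> 'b"
  assumes bij: "bij_betw h (Pow S) (carrier L)"
    and le_iff: "\<lbrakk>A \<subseteq> S; B \<subseteq> S\<rbrakk> \<Longrightarrow> h A \<sqsubseteq> h B \<longleftrightarrow> A \<subseteq> B"
    and eq_is_eq: "eq L = (=)"
begin

lemma closed [simp]: "A \<subseteq> S \<Longrightarrow> h A \<in> carrier L"
  using bij by (auto simp: bij_betw_def)

lemma obtain_set:
  assumes "x \<in> carrier L"
  obtains A where "A \<subseteq> S" "x = h A"
  using assms bij by (auto simp: bij_betw_def)

lemma obtain_family:
  assumes "C \<subseteq> carrier L"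
  obtains \<A> where "\<A> \<subseteq> Pow S" "C = h ` \<A>"
  using assms bij by (metis bij_betw_def subset_imageE)

lemma eq_iff [simp]: "\<lbrakk>A \<subseteq> S; B \<subseteq> S\<rbrakk> \<Longrightarrow> h A = h B \<longleftrightarrow> A = B"
  using bij by (auto simp: bij_betw_def inj_on_def)

lemma is_partial_order: "partial_order L"
proof unfold_locales
  show "x \<sqsubseteq> z" if "x \<sqsubseteq> y" "y \<sqsubseteq> z" "x \<in> carrier L" "y \<in> carrier L" "z \<in> carrier L" for x y z
    using that by (elim obtain_set) (auto simp: le_iff)
qed (auto simp: eq_is_eq le_iff elim!: obtain_set)

sublocale partial_order L
  by (rule is_partial_order)

lemma lub:
  assumes "\<A> \<subseteq> Pow S"
  shows "least L (h (\<Union>\<A>)) (Upper L (h ` \<A>))"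
proof (rule least_UpperI)
  show "h (\<Union>\<A>) \<sqsubseteq> y" if y: "y \<in> Upper L (h ` \<A>)" for y
  proof -
    have "y \<in> carrier L"
      using y by (simp add: Upper_def)
    then obtain B where B: "B \<subseteq> S" "y = h B"
      by (rule obtain_set)
    have "A \<subseteq> B" if "A \<in> \<A>" for A
      using y that assms B by (auto simp: Upper_def le_iff subset_iff)
    then show ?thesis
      using assms B by (subst B(2), subst le_iff) auto
  qed
next
  show "x \<sqsubseteq> h (\<Union>\<A>)" if "x \<in> h ` \<A>" for x
  proof -
    obtain A where A: "A \<in> \<A>" "x = h A"
      using \<open>x \<in> h ` \<A>\<close> by (rule imageE)
    with assms have "A \<subseteq> S" "\<Union>\<A> \<subseteq> S" "A \<subseteq> \<Union>\<A>"
      by auto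
    then show ?thesis
      by (simp add: A le_iff)
  qed
qed (use assms in \<open>auto intro!: closed\<close>)

text \<open>The intersection with \<open>S\<close> matters for the empty family: its meet is the top
  element \<open>h S\<close>, while \<open>\<Inter>{}\<close> is the whole type.\<close>

lemma glb:
  assumes "\<A> \<subseteq> Pow S"
  shows "greatest L (h (S \<inter> \<Inter>\<A>)) (Lower L (h ` \<A>))"
proof (rule greatest_LowerI)
  show "y \<sqsubseteq> h (S \<inter> \<Inter>\<A>)" if y: "y \<in> Lower L (h ` \<A>)" for y
  proof -
    have "y \<in> carrier L"
      using y by (simp add: Lower_def)
    then obtain B where B: "B \<subseteq> S" "y = h B"
      by (rule obtain_set)
    have "B \<subseteq> A" if "A \<in> \<A>" for A
      using y that assms B by (auto simp: Lower_def le_iff subset_iff)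
    then show ?thesis
      using assms B by (subst B(2), subst le_iff) auto
  qed
next
  show "h (S \<inter> \<Inter>\<A>) \<sqsubseteq> x" if "x \<in> h ` \<A>" for x
  proof -
    obtain A where A: "A \<in> \<A>" "x = h A"
      using \<open>x \<in> h ` \<A>\<close> by (rule imageE)
    with assms have "A \<subseteq> S" "S \<inter> \<Inter>\<A> \<subseteq> A"
      by auto
    then show ?thesis
      by (simp add: A le_iff)
  qed
qed (use assms in \<open>auto intro!: closed\<close>)

sublocale Complete_Lattice.complete_lattice L
proof unfold_locales
  fix C assume "C \<subseteq> carrier L"
  then obtain \<A> where "\<A> \<subseteq> Pow S" "C = h ` \<A>"
    by (rule obtain_family)
  then show "\<exists>s. least L s (Upper L C)" "\<exists>i. greatest L i (Lower L C)"
    using lub glb by blast+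
qed

lemma sup_image: "\<A> \<subseteq> Pow S \<Longrightarrow> \<Squnion>(h ` \<A>) = h (\<Union>\<A>)"
  \<comment> \<open>The supremum is defined by Hilbert choice, so its value is pinned down by
    uniqueness of least upper bounds.\<close>
  using lub[of \<A>] unfolding Lattice.sup_def
  by (metis (mono_tags, lifting) least_unique someI_ex)

lemma inf_image: "\<A> \<subseteq> Pow S \<Longrightarrow> \<Sqinter>(h ` \<A>) = h (S \<inter> \<Inter>\<A>)"
  using glb[of \<A>] unfolding Lattice.inf_def
  by (metis (mono_tags, lifting) greatest_unique someI_ex)

lemma join [simp]: "\<lbrakk>A \<subseteq> S; B \<subseteq> S\<rbrakk> \<Longrightarrow> h A \<squnion> h B = h (A \<union> B)"
  using sup_image[of "{A, B}"] by (simp add: join_def)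

lemma meet [simp]: "\<lbrakk>A \<subseteq> S; B \<subseteq> S\<rbrakk> \<Longrightarrow> h A \<sqinter> h B = h (A \<inter> B)"
  using inf_image[of "{A, B}"] by (simp add: meet_def Int_absorb1 le_infI1)

lemma bottom [simp]: "\<bottom> = h {}"
  using sup_image[of "{}"] weak_sup_empty[unfolded eq_is_eq] by simp

lemma top [simp]: "\<top> = h S"
  using inf_image[of "{}"] weak_inf_empty[unfolded eq_is_eq] by simp

lemma compl [simp]:
  assumes "A \<subseteq> S"
  shows "bcompl L (h A) = h (S - A)"
  unfolding bcompl_def
proof (rule the_equality)
  fix b assume b: "b \<in> carrier L \<and> h A \<sqinter> b = \<bottom> \<and> h A \<squnion> b = \<top>"
  then have "b \<in> carrier L" ..
  then obtain B where "B \<subseteq> S" "b = h B"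
    by (rule obtain_set)
  with b assms have "A \<inter> B = {}" "A \<union> B = S"
    by (auto simp: le_infI1)
  then show "b = h (S - A)"
    using \<open>b = h B\<close> by (metis Diff_cancel Un_Diff Diff_triv Int_commute sup_bot_left)
qed (use assms in \<open>auto simp: Un_absorb1\<close>)

sublocale complete_boolean_lattice L
proof unfold_locales
  show "x \<sqinter> (y \<squnion> z) = (x \<sqinter> y) \<squnion> (x \<sqinter> z)"
    if "x \<in> carrier L" "y \<in> carrier L" "z \<in> carrier L" for x y z
    using that by (elim obtain_set) (simp add: le_infI1 Int_Un_distrib)
  show "\<exists>y\<in>carrier L. x \<sqinter> y = \<bottom> \<and> x \<squnion> y = \<top>" if "x \<in> carrier L" for x
    using that
  proof (elim obtain_set)
    fix A assume "A \<subseteq> S" "x = h A"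
    then show ?thesis
      by (intro bexI[of _ "h (S - A)"]) (auto simp: Un_absorb1)
  qed
qed

end

text \<open>With box corresponding to interior, the MT-axioms become the standard properties of
  interiors, and diamond becomes closure.\<close>

locale space_representation = powerset_representation L "topspace Y" h
  for L :: "('b, 'c) mt_scheme" (structure) and Y :: "'a topology" and h :: "'a set \<Rightarrow> 'b" +
  assumes box: "A \<subseteq> topspace Y \<Longrightarrow> mt_box L (h A) = h (Y interior_of A)"
begin

sublocale mt_algebra L
proof unfold_locales
  show "mt_box L \<top> = \<top>"
    by (simp add: box)
qed (elim obtain_set; simp add: box interior_of_Int interior_of_subset interior_of_subset_topspace
       le_infI1 le_iff)+

lemma diamond: "A \<subseteq> topspace Y \<Longrightarrow> mt_diamond L (h A) = h (Y closure_of A)"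
  by (simp add: mt_diamond_def box interior_of_subset_topspace interior_of_complement
       closure_of_subset_topspace double_diff)

lemma opens: "mt_opens L = h ` {U. openin Y U}"
proof (intro Set.set_eqI iffI)
  fix x assume "x \<in> mt_opens L"
  then have x: "x \<in> carrier L" "x = mt_box L x"
    by (auto simp: mt_opens_def)
  then obtain A where A: "A \<subseteq> topspace Y" "x = h A"
    by (blast elim: obtain_set)
  with x have "x = h (Y interior_of A)"
    by (simp add: box)
  then show "x \<in> h ` {U. openin Y U}"
    by (rule image_eqI) simp
next
  fix x assume "x \<in> h ` {U. openin Y U}"
  then obtain U where "openin Y U" "x = h U"
    by (elim imageE) simp
  then show "x \<in> mt_opens L"
    by (simp add: mt_opens_def openin_subset box interior_of_openin)
qed

lemma atoms: "mt_atoms L = (\<lambda>y. h {y}) ` topspace Y"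
proof (intro Set.set_eqI iffI)
  fix x assume x: "x \<in> mt_atoms L"
  then have "x \<in> carrier L"
    by (simp add: mt_atoms_def)
  then obtain A where A: "A \<subseteq> topspace Y" "x = h A"
    by (rule obtain_set)
  with x have "A \<noteq> {}"
    by (simp add: mt_atoms_def)
  then obtain y where y: "y \<in> A"
    by (meson ex_in_conv)
  \<comment> \<open>The singleton of any point of \<open>A\<close> lies below \<open>A\<close> and
    is nonempty, so minimality of the atom forces it to be all of \<open>A\<close>.\<close>
  have "{y} \<subseteq> topspace Y"
    using A y by (simp add: subset_iff)
  moreover from this have "h {y} \<in> carrier L" "h {y} \<sqsubseteq> h A"
    using A y by (simp_all add: le_iff)
  then have "h {y} = h {} \<or> h {y} = h A"
    using x A(2) by (simp add: mt_atoms_def)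
  ultimately have "{y} = A" "y \<in> topspace Y"
    using A(1) eq_iff[of "{y}" "{}"] eq_iff[of "{y}" A] by simp_all
  then show "x \<in> (\<lambda>y. h {y}) ` topspace Y"
    using A(2) by (intro image_eqI[of _ _ y]) simp_all
next
  fix x assume "x \<in> (\<lambda>y. h {y}) ` topspace Y"
  then obtain y where y: "y \<in> topspace Y" "x = h {y}"
    by (rule imageE)
  moreover have "z = h {} \<or> z = h {y}" if "z \<in> carrier L" "z \<sqsubseteq> h {y}" for z
    using that y by (elim obtain_set) (simp add: le_iff subset_singleton_iff)
  ultimately show "x \<in> mt_atoms L"
    by (simp add: mt_atoms_def)
qed

text \<open>The atoms below \<open>h U\<close> are the \<open>h {y}\<close> with \<open>y\<close> in
  \<open>U\<close>. The atom space therefore carries the image topology along the injective map that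
  sends \<open>y\<close> to \<open>h {y}\<close>.\<close>

lemma homeomorphic_atom_space: "Y homeomorphic_space atom_space L"
proof -
  have atoms_below: "{x \<in> mt_atoms L. x \<sqsubseteq> h U} = (\<lambda>y. h {y}) ` U" if "openin Y U" for U
  proof -
    have "h {y} \<sqsubseteq> h U \<longleftrightarrow> y \<in> U" if "y \<in> topspace Y" for y
      using that openin_subset[OF \<open>openin Y U\<close>] by (simp add: le_iff)
    then show ?thesis
      using openin_subset[OF that] by (auto simp: atoms)
  qed
  have "(\<exists>u\<in>mt_opens L. W = {x \<in> mt_atoms L. x \<sqsubseteq> u})
      \<longleftrightarrow> (\<exists>U. openin Y U \<and> W = (\<lambda>y. h {y}) ` U)" for W
  proof -
    have "(\<exists>u\<in>mt_opens L. W = {x \<in> mt_atoms L. x \<sqsubseteq> u})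
        \<longleftrightarrow> (\<exists>U. openin Y U \<and> W = {x \<in> mt_atoms L. x \<sqsubseteq> h U})"
      by (simp add: opens Bex_def image_iff) metis
    also have "\<dots> \<longleftrightarrow> (\<exists>U. openin Y U \<and> W = (\<lambda>y. h {y}) ` U)"
      by (rule arg_cong[where f = Ex]) (simp add: fun_eq_iff atoms_below cong: conj_cong)
    finally show ?thesis .
  qed
  moreover have "inj_on (\<lambda>y. h {y}) (topspace Y)"
    by (rule inj_onI) simp
  ultimately show ?thesis
    unfolding atom_space_def by (simp only: homeomorphic_space_image_topology)
qed

end

section \<open>Isomorphisms between two algebras that represent the same space\<close>

lemma mt_morphism_representations:
  assumes "space_representation L Y h" and "space_representation M Y k"
  shows "mt_morphism L M (\<lambda>x. k (inv_into (Pow (topspace Y)) h x))"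
proof -
  interpret L: space_representation L Y h by fact
  interpret M: space_representation M Y k by fact
  \<comment> \<open>Decode an element of \<open>L\<close> to a subset of the space, then encode it
    in \<open>M\<close>. Joins, meets, complements and interiors are all computed on that subset, so
    \<open>f\<close> preserves them; for box even equality holds.\<close>
  define f where "f = (\<lambda>x. k (inv_into (Pow (topspace Y)) h x))"
  have f: "f (h A) = k A" if "A \<subseteq> topspace Y" for A
    using that L.bij by (simp add: f_def bij_betw_def)
  have f_image: "f ` h ` \<A> = k ` \<A>" if "\<A> \<subseteq> Pow (topspace Y)" for \<A>
    unfolding image_image using that by (intro image_cong refl f) (simp add: subset_iff)
  have "complete_boolean_hom L M f"
    unfolding complete_boolean_hom_def
  proof (intro conjI ballI allI impI)
    show "f \<in> carrier L \<rightarrow> carrier M"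
      by (intro funcsetI, elim L.obtain_set) (simp add: f)
  next
    fix C assume "C \<subseteq> carrier L"
    then obtain \<A> where "\<A> \<subseteq> Pow (topspace Y)" "C = h ` \<A>"
      by (rule L.obtain_family)
    moreover from this have "\<Union>\<A> \<subseteq> topspace Y"
      using Union_mono[of \<A> "Pow (topspace Y)"] by simp
    ultimately show "f (\<Squnion>\<^bsub>L\<^esub>C) = \<Squnion>\<^bsub>M\<^esub>(f ` C)" "f (\<Sqinter>\<^bsub>L\<^esub>C) = \<Sqinter>\<^bsub>M\<^esub>(f ` C)"
      by (simp_all add: f_image L.sup_image M.sup_image L.inf_image M.inf_image f)
  next
    fix a assume "a \<in> carrier L"
    then show "f (bcompl L a) = bcompl M (f a)"
      by (elim L.obtain_set) (simp add: f)
  qed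
  moreover have "f (mt_box L a) \<sqsubseteq>\<^bsub>M\<^esub> mt_box M (f a)" if "a \<in> carrier L" for a
    using that by (elim L.obtain_set) (simp add: L.box M.box f interior_of_subset_topspace)
  ultimately show ?thesis
    using L.mt_algebra_axioms M.mt_algebra_axioms by (simp add: mt_morphism_def f_def)
qed

text \<open>The situation is symmetric in \<open>L\<close> and \<open>M\<close>: the two
  decode-and-encode maps are both morphisms and cancel each other on the carriers.\<close>

lemma mt_isomorphic_representations:
  assumes "space_representation L Y h" and "space_representation M Y k"
  shows "L \<cong>\<^sub>M\<^sub>T M"
proof -
  interpret L: space_representation L Y h by fact
  interpret M: space_representation M Y k by fact
  let ?f = "\<lambda>x. k (inv_into (Pow (topspace Y)) h x)"
  let ?g = "\<lambda>x. h (inv_into (Pow (topspace Y)) k x)"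
  have h_inv: "inv_into (Pow (topspace Y)) h (h A) = A"
    and k_inv: "inv_into (Pow (topspace Y)) k (k A) = A" if "A \<subseteq> topspace Y" for A
    using that L.bij M.bij by (simp_all add: bij_betw_def)
  have "?g (?f a) = a" if "a \<in> carrier L" for a
    using that by (elim L.obtain_set) (simp add: h_inv k_inv)
  moreover have "?f (?g b) = b" if "b \<in> carrier M" for b
    using that by (elim M.obtain_set) (simp add: h_inv k_inv)
  ultimately show ?thesis
    unfolding mt_isomorphic_def
    by (intro exI[of _ ?f] exI[of _ ?g] conjI ballI mt_morphism_representations assms)
qed

lemma powerset_mt_representation: "space_representation (powerset_mt Y) Y (\<lambda>A. A)"
  by unfold_locales (auto simp: powerset_mt_def bij_betw_def)

section \<open>Filters in a lattice of subsets\<close>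

lemma powerset_mt_simps [simp]:
  "carrier (powerset_mt Y) = Pow (topspace Y)"
  "le (powerset_mt Y) = (\<subseteq>)"
  "eq (powerset_mt Y) = (=)"
  "mt_box (powerset_mt Y) = (\<lambda>A. Y interior_of A)"
  by (simp_all add: powerset_mt_def)

lemma powerset_mt_powerset_representation:
  "powerset_representation (powerset_mt Y) (topspace Y) (\<lambda>A. A)"
  using powerset_mt_representation by (rule space_representation.axioms(1))

lemmas powerset_mt_meet = powerset_representation.meet[OF powerset_mt_powerset_representation]
  and powerset_mt_bottom = powerset_representation.bottom[OF powerset_mt_powerset_representation]
  and powerset_mt_inf =
    powerset_representation.inf_image[OF powerset_mt_powerset_representation, unfolded image_ident]
  and powerset_mt_diamond = space_representation.diamond[OF powerset_mt_representation]

text \<open>A filter lies in some basic set indexed by \<open>S\<close> exactly if it misses some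
  member of \<open>S\<close>. This gives a normal form for open sets that can be matched with
  complements of closed elements.\<close>

lemma arbitrary_union_of_separated:
  "(arbitrary union_of (\<lambda>U. \<exists>Z\<in>B. U = M - {F \<in> M. Z \<in> F})) U
    \<longleftrightarrow> (\<exists>S\<subseteq>B. U = {F \<in> M. \<not> S \<subseteq> F})"
proof
  assume "(arbitrary union_of (\<lambda>U. \<exists>Z\<in>B. U = M - {F \<in> M. Z \<in> F})) U"
  then obtain \<U> where \<U>: "\<And>V. V \<in> \<U> \<Longrightarrow> \<exists>Z\<in>B. V = M - {F \<in> M. Z \<in> F}" "U = \<Union>\<U>"
    by (auto simp: union_of_def arbitrary_def)
  have "\<Union>\<U> = {F \<in> M. \<not> {Z \<in> B. M - {F \<in> M. Z \<in> F} \<in> \<U>} \<subseteq> F}" (is "?l = ?r")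
  proof
    show "?l \<subseteq> ?r"
    proof
      fix F assume "F \<in> \<Union>\<U>"
      then obtain V where "V \<in> \<U>" "F \<in> V"
        by blast
      moreover from this \<U>(1) obtain Z where "Z \<in> B" "V = M - {F \<in> M. Z \<in> F}"
        by meson
      ultimately show "F \<in> ?r"
        by blast
    qed
  qed blast
  then show "\<exists>S\<subseteq>B. U = {F \<in> M. \<not> S \<subseteq> F}"
    unfolding \<U>(2) by (intro exI[of _ "{Z \<in> B. M - {F \<in> M. Z \<in> F} \<in> \<U>}"]) blast
next
  assume "\<exists>S\<subseteq>B. U = {F \<in> M. \<not> S \<subseteq> F}"
  then obtain S where S: "S \<subseteq> B" "U = {F \<in> M. \<not> S \<subseteq> F}"
    by blast
  then have "U = \<Union>((\<lambda>Z. M - {F \<in> M. Z \<in> F}) ` S)"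
    by blast
  moreover have "(\<lambda>Z. M - {F \<in> M. Z \<in> F}) ` S \<subseteq> {V. \<exists>Z\<in>B. V = M - {F \<in> M. Z \<in> F}}"
    using S by blast
  ultimately show "(arbitrary union_of (\<lambda>U. \<exists>Z\<in>B. U = M - {F \<in> M. Z \<in> F})) U"
    by (simp add: union_of_def arbitrary_def) blast
qed

text \<open>Isolates what the filter argument uses of the zero-elements: they form a bounded
  sublattice of the powerset.\<close>

locale set_lattice =
  fixes X :: "'a topology" and B :: "'a set set"
  assumes subsets: "A \<in> B \<Longrightarrow> A \<subseteq> topspace X"
    and empty_mem [simp]: "{} \<in> B"
    and topspace_mem [simp]: "topspace X \<in> B"
    and Int_mem: "\<lbrakk>A \<in> B; C \<in> B\<rbrakk> \<Longrightarrow> A \<inter> C \<in> B"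
    and Un_mem: "\<lbrakk>A \<in> B; C \<in> B\<rbrakk> \<Longrightarrow> A \<union> C \<in> B"
begin

abbreviation "\<P> \<equiv> proper_filters (powerset_mt X) B"
abbreviation "\<M> \<equiv> maximal_filters (powerset_mt X) B"

lemma proper_filters_iff:
  "F \<in> \<P> \<longleftrightarrow> F \<subseteq> B \<and> F \<noteq> {} \<and> {} \<notin> F \<and>
     (\<forall>a\<in>F. \<forall>b\<in>B. a \<subseteq> b \<longrightarrow> b \<in> F) \<and> (\<forall>a\<in>F. \<forall>b\<in>F. a \<inter> b \<in> F)"
proof (cases "F \<subseteq> B")
  case True
  then have "(\<forall>a\<in>F. \<forall>b\<in>F. meet (powerset_mt X) a b \<in> F) \<longleftrightarrow> (\<forall>a\<in>F. \<forall>b\<in>F. a \<inter> b \<in> F)"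
    by (simp add: powerset_mt_meet subsets subsetD)
  \<comment> \<open>The empty set lies below every member of \<open>B\<close>, so an upset
    containing it is all of \<open>B\<close>.\<close>
  moreover have "F \<noteq> B \<longleftrightarrow> {} \<notin> F" if up: "\<forall>a\<in>F. \<forall>b\<in>B. a \<subseteq> b \<longrightarrow> b \<in> F"
  proof
    show "{} \<notin> F" if "F \<noteq> B"
    proof
      assume "{} \<in> F"
      then have "B \<subseteq> F"
        using up by blast
      with True that show False
        by blast
    qed
    show "F \<noteq> B" if "{} \<notin> F"
      using that empty_mem by blast
  qed
  ultimately show ?thesis
    using True unfolding proper_filters_def mem_Collect_eq powerset_mt_simps
    by argo
qed (simp add: proper_filters_def)

lemma proper_filtersD:
  assumes "F \<in> \<P>"
  shows "F \<subseteq> B" "{} \<notin> F" "\<lbrakk>a \<in> F; b \<in> B; a \<subseteq> b\<rbrakk> \<Longrightarrow> b \<in> F" "\<lbrakk>a \<in> F; b \<in> F\<rbrakk> \<Longrightarrow> a \<inter> b \<in> F"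
  using assms by (simp_all add: proper_filters_iff)

lemma topspace_in_filter: "F \<in> \<P> \<Longrightarrow> topspace X \<in> F"
  by (metis proper_filters_iff subsets ex_in_conv subsetD topspace_mem)

section \<open>Maximal filters: existence, membership criterion and primeness\<close>

lemma maximal_proper: "m \<in> \<M> \<Longrightarrow> m \<in> \<P>"
  by (simp add: maximal_filters_def)

lemma maximal_eq: "\<lbrakk>m \<in> \<M>; F \<in> \<P>; m \<subseteq> F\<rbrakk> \<Longrightarrow> F = m"
  by (simp add: maximal_filters_def)

lemma Union_chain_proper:
  assumes "\<C> \<noteq> {}" "\<C> \<subseteq> \<P>" and chain: "\<And>F G. \<lbrakk>F \<in> \<C>; G \<in> \<C>\<rbrakk> \<Longrightarrow> F \<subseteq> G \<or> G \<subseteq> F"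
  shows "\<Union>\<C> \<in> \<P>"
  unfolding proper_filters_iff
proof (intro conjI ballI impI)
  have mem: "F \<in> \<P>" if "F \<in> \<C>" for F
    using that assms by blast
  show "\<Union>\<C> \<subseteq> B"
    by (rule Union_least) (rule proper_filtersD(1)[OF mem])
  show "{} \<notin> \<Union>\<C>"
    using proper_filtersD(2)[OF mem] by (metis UnionE)
  show "\<Union>\<C> \<noteq> {}"
    using topspace_in_filter[OF mem] \<open>\<C> \<noteq> {}\<close> by (metis UnionI empty_iff ex_in_conv)
  show "b \<in> \<Union>\<C>" if "a \<in> \<Union>\<C>" "b \<in> B" "a \<subseteq> b" for a b
    using that proper_filtersD(3)[OF mem] by (metis UnionE UnionI)
  show "a \<inter> b \<in> \<Union>\<C>" if "a \<in> \<Union>\<C>" "b \<in> \<Union>\<C>" for a b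
  proof -
    from that obtain F G where FG: "F \<in> \<C>" "a \<in> F" "G \<in> \<C>" "b \<in> G"
      by (elim UnionE)
    \<comment> \<open>Comparability puts both sets into the larger of the two filters, which is
      closed under intersection.\<close>
    from chain[OF FG(1,3)] have "a \<in> G \<or> b \<in> F"
      using FG(2,4) by (auto dest: subsetD)
    then show ?thesis
      using FG proper_filtersD(4)[OF mem] by (auto intro: UnionI)
  qed
qed

lemma extend_maximal:
  assumes "F \<in> \<P>"
  obtains m where "m \<in> \<M>" "F \<subseteq> m"
proof -
  have "\<exists>m\<in>{G \<in> \<P>. F \<subseteq> G}. \<forall>G\<in>{G \<in> \<P>. F \<subseteq> G}. m \<subseteq> G \<longrightarrow> G = m"
  proof (rule subset_Zorn_nonempty)
    show "{G \<in> \<P>. F \<subseteq> G} \<noteq> {}"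
      using assms by blast
    fix \<C> assume "\<C> \<noteq> {}" "subset.chain {G \<in> \<P>. F \<subseteq> G} \<C>"
    then have sub: "\<C> \<subseteq> {G \<in> \<P>. F \<subseteq> G}" and chain: "\<forall>G\<in>\<C>. \<forall>H\<in>\<C>. G \<subseteq> H \<or> H \<subseteq> G"
      by (simp_all add: subset_chain_def)
    from \<open>\<C> \<noteq> {}\<close> obtain G where "G \<in> \<C>" "F \<subseteq> G"
      using sub by (metis (no_types, lifting) ex_in_conv mem_Collect_eq subsetD)
    then have "F \<subseteq> \<Union>\<C>"
      by (meson Union_upper order_trans)
    moreover have "\<C> \<subseteq> \<P>"
      using sub by (simp add: subset_iff)
    then have "\<Union>\<C> \<in> \<P>"
      using \<open>\<C> \<noteq> {}\<close> chain by (intro Union_chain_proper) simp_all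
    ultimately show "\<Union>\<C> \<in> {G \<in> \<P>. F \<subseteq> G}"
      by simp
  qed
  then obtain m where m: "m \<in> {G \<in> \<P>. F \<subseteq> G}" "\<forall>G\<in>{G \<in> \<P>. F \<subseteq> G}. m \<subseteq> G \<longrightarrow> G = m"
    by (rule bexE)
  have "G = m" if "G \<in> \<P>" "m \<subseteq> G" for G
    using m that order_trans[of F m G] by simp
  \<comment> \<open>Zorn's lemma gave maximality only among the filters above \<open>F\<close>.
    Whatever contains \<open>m\<close> also contains \<open>F\<close>, so \<open>m\<close> is
    maximal among all proper filters.\<close>
  then show thesis
    using m(1) by (intro that[of m]) (simp_all add: maximal_filters_def)
qed

lemma adjoin:
  assumes F: "F \<in> \<P>" and b: "b \<in> B" and meets: "\<And>a. a \<in> F \<Longrightarrow> b \<inter> a \<noteq> {}"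
  obtains G where "G \<in> \<P>" "F \<subseteq> G" "b \<in> G"
proof
  \<comment> \<open>This is the filter generated by \<open>F\<close> and \<open>b\<close>; it omits
    the empty set because \<open>b\<close> meets every member of \<open>F\<close>.\<close>
  let ?G = "{c \<in> B. \<exists>a\<in>F. b \<inter> a \<subseteq> c}"
  show "F \<subseteq> ?G"
    using proper_filtersD(1)[OF F] by blast
  show "b \<in> ?G"
    using b topspace_in_filter[OF F] by blast
  show "?G \<in> \<P>"
    unfolding proper_filters_iff
  proof (intro conjI ballI impI)
    show "?G \<noteq> {}"
      using \<open>b \<in> ?G\<close> by blast
    show "{} \<notin> ?G"
      using meets by blast
    show "d \<in> ?G" if "c \<in> ?G" "d \<in> B" "c \<subseteq> d" for c d
      using that by blast
    show "c \<inter> d \<in> ?G" if "c \<in> ?G" "d \<in> ?G" for c d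
    proof -
      from that obtain a a' where aa': "a \<in> F" "b \<inter> a \<subseteq> c" "a' \<in> F" "b \<inter> a' \<subseteq> d"
        by (elim CollectE conjE bexE)
      have "b \<inter> (a \<inter> a') \<subseteq> c \<inter> d"
        using aa'(2,4) by blast
      moreover have "a \<inter> a' \<in> F"
        using proper_filtersD(4)[OF F aa'(1,3)] .
      moreover have "c \<inter> d \<in> B"
        using that Int_mem by blast
      ultimately show ?thesis
        by blast
    qed
  qed blast
qed

text \<open>If \<open>b\<close> meets every member of \<open>m\<close>, adjoining it yields a proper
  filter above \<open>m\<close>, which maximality identifies with \<open>m\<close>.\<close>

lemma mem_maximal_iff:
  assumes m: "m \<in> \<M>" and b: "b \<in> B"
  shows "b \<in> m \<longleftrightarrow> (\<forall>a\<in>m. b \<inter> a \<noteq> {})"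
proof
  show "\<forall>a\<in>m. b \<inter> a \<noteq> {}" if "b \<in> m"
    using that proper_filtersD(2,4)[OF maximal_proper[OF m]] by metis
  assume "\<forall>a\<in>m. b \<inter> a \<noteq> {}"
  then obtain G where "G \<in> \<P>" "m \<subseteq> G" "b \<in> G"
    using adjoin[OF maximal_proper[OF m] b] by metis
  then show "b \<in> m"
    using maximal_eq[OF m] by metis
qed

text \<open>If \<open>m\<close> omits both \<open>a\<close> and \<open>b\<close>, it has members
  disjoint from each; their intersection is a member disjoint from the union. Primeness is what
  makes the basic open sets closed under binary intersection.\<close>

lemma maximal_prime:
  assumes m: "m \<in> \<M>" and "a \<in> B" "b \<in> B"
  shows "a \<union> b \<in> m \<longleftrightarrow> a \<in> m \<or> b \<in> m"
proof
  show "a \<union> b \<in> m" if "a \<in> m \<or> b \<in> m"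
    using that proper_filtersD(3)[OF maximal_proper[OF m]] Un_mem assms by blast
  assume ab: "a \<union> b \<in> m"
  show "a \<in> m \<or> b \<in> m"
  proof (rule ccontr)
    assume "\<not> (a \<in> m \<or> b \<in> m)"
    then obtain a' b' where "a' \<in> m" "a \<inter> a' = {}" "b' \<in> m" "b \<inter> b' = {}"
      using mem_maximal_iff assms by metis
    then have "a' \<inter> b' \<in> m" "(a \<union> b) \<inter> (a' \<inter> b') = {}"
      using proper_filtersD(4)[OF maximal_proper[OF m]] by blast+
    then show False
      using ab mem_maximal_iff[OF m] Un_mem assms by metis
  qed
qed

text \<open>The largest upset of proper filters whose maximal members all lie in
  \<open>S\<close>.\<close>

definition reg_of :: "'a set set set \<Rightarrow> 'a set set set" where
  "reg_of S = {x \<in> \<P>. \<forall>m\<in>\<M>. x \<subseteq> m \<longrightarrow> m \<in> S}"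

text \<open>The only maximal filter above \<open>m\<close> is \<open>m\<close> itself. Hence a set
  of maximal filters can be recovered from its upset.\<close>

lemma maximal_mem_reg_of_iff: "m \<in> \<M> \<Longrightarrow> m \<in> reg_of S \<longleftrightarrow> m \<in> S"
  unfolding reg_of_def using maximal_proper maximal_eq by blast

lemma reg_of_subset_iff:
  assumes "S \<subseteq> \<M>"
  shows "reg_of S \<subseteq> reg_of T \<longleftrightarrow> S \<subseteq> T"
proof
  show "S \<subseteq> T" if "reg_of S \<subseteq> reg_of T"
    using that assms maximal_mem_reg_of_iff by blast
qed (auto simp: reg_of_def)

lemma reg_of_upset: "\<lbrakk>x \<in> reg_of S; y \<in> \<P>; x \<subseteq> y\<rbrakk> \<Longrightarrow> y \<in> reg_of S"
  unfolding reg_of_def by blast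

text \<open>This is the regularity of \<open>reg_of S\<close>. Density at a maximal filter
  \<open>m\<close> above \<open>x\<close> yields some \<open>z\<close> in \<open>reg_of S\<close>
  above \<open>m\<close>; then \<open>z\<close> is \<open>m\<close>, so \<open>m\<close> lies in
  \<open>S\<close>.\<close>

lemma mem_reg_of_iff_dense:
  assumes "x \<in> \<P>"
  shows "x \<in> reg_of S \<longleftrightarrow> {y \<in> \<P>. x \<subseteq> y} \<subseteq> {y \<in> \<P>. \<exists>z \<in> reg_of S. y \<subseteq> z}"
proof
  show "{y \<in> \<P>. x \<subseteq> y} \<subseteq> {y \<in> \<P>. \<exists>z \<in> reg_of S. y \<subseteq> z}" if "x \<in> reg_of S"
    using that reg_of_upset by blast
  assume dense: "{y \<in> \<P>. x \<subseteq> y} \<subseteq> {y \<in> \<P>. \<exists>z \<in> reg_of S. y \<subseteq> z}"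
  have "m \<in> S" if "m \<in> \<M>" "x \<subseteq> m" for m
  proof -
    have "m \<in> {y \<in> \<P>. x \<subseteq> y}"
      using that maximal_proper by simp
    then have "m \<in> {y \<in> \<P>. \<exists>z \<in> reg_of S. y \<subseteq> z}"
      by (rule subsetD[OF dense])
    then obtain z where z: "z \<in> reg_of S" "m \<subseteq> z"
      by (elim CollectE conjE bexE)
    moreover have "z \<in> \<P>"
      using z(1) by (simp add: reg_of_def)
    ultimately have "m \<in> reg_of S"
      using maximal_eq[OF \<open>m \<in> \<M>\<close>] by metis
    then show ?thesis
      using that maximal_mem_reg_of_iff by blast
  qed
  then show "x \<in> reg_of S"
    using assms unfolding reg_of_def by blast
qed

section \<open>The algebra of regular open sets as a powerset\<close>

abbreviation "\<R> \<equiv> regular_opens (powerset_mt X) B"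

lemma mem_regular_opens_iff:
  "U \<in> carrier \<R> \<longleftrightarrow> U \<subseteq> \<P> \<and> (\<forall>x\<in>U. \<forall>y\<in>\<P>. x \<subseteq> y \<longrightarrow> y \<in> U) \<and>
    (\<forall>x\<in>\<P>. x \<in> U \<longleftrightarrow> {y \<in> \<P>. x \<subseteq> y} \<subseteq> {y \<in> \<P>. \<exists>z \<in> U. y \<subseteq> z})"
proof (cases "U \<subseteq> \<P>")
  case True
  then have "U = {x \<in> \<P>. Q x} \<longleftrightarrow> (\<forall>x\<in>\<P>. x \<in> U \<longleftrightarrow> Q x)" for Q
    by blast
  then show ?thesis
    using True by (simp only: regular_opens_def Let_def partial_object.simps mem_Collect_eq)
qed (simp add: regular_opens_def Let_def)

text \<open>A regular open \<open>U\<close> is determined by its maximal members, because every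
  proper filter has a maximal one above it.\<close>

lemma carrier_regular_opens: "carrier \<R> = reg_of ` Pow \<M>"
proof (intro equalityI subsetI)
  fix U assume "U \<in> reg_of ` Pow \<M>"
  then obtain S where S: "U = reg_of S"
    by (rule imageE)
  show "U \<in> carrier \<R>"
    unfolding mem_regular_opens_iff S
  proof (intro conjI ballI impI)
    show "reg_of S \<subseteq> \<P>"
      by (simp add: reg_of_def Collect_restrict)
  qed (simp only: reg_of_upset mem_reg_of_iff_dense)+
next
  fix U assume "U \<in> carrier \<R>"
  note * = mem_regular_opens_iff[THEN iffD1, OF this]
  note U = conjunct1[OF *] conjunct1[OF conjunct2[OF *]] and dense = conjunct2[OF conjunct2[OF *]]
  have "x \<in> U" if x: "x \<in> reg_of (U \<inter> \<M>)" for x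
  proof (rule bspec[OF dense, THEN iffD2])
    show "x \<in> \<P>"
      using x by (simp add: reg_of_def)
    \<comment> \<open>A maximal extension of \<open>y\<close> also extends \<open>x\<close>, hence
      lies in \<open>U\<close>. So \<open>U\<close> is dense above \<open>x\<close>, and regularity
      puts \<open>x\<close> into \<open>U\<close>.\<close>
    have "\<exists>z\<in>U. y \<subseteq> z" if "y \<in> \<P>" "x \<subseteq> y" for y
    proof -
      obtain m where "m \<in> \<M>" "y \<subseteq> m"
        using extend_maximal \<open>y \<in> \<P>\<close> by metis
      moreover from this have "m \<in> U \<inter> \<M>"
        using x order_trans[OF \<open>x \<subseteq> y\<close>] by (simp add: reg_of_def)
      ultimately show ?thesis
        by (simp add: bexI[of _ m])
    qed
    then show "{y \<in> \<P>. x \<subseteq> y} \<subseteq> {y \<in> \<P>. \<exists>z \<in> U. y \<subseteq> z}"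
      by (simp add: Collect_mono)
  qed
  moreover have "x \<in> reg_of (U \<inter> \<M>)" if "x \<in> U" for x
  proof -
    have "x \<in> \<P>"
      using U(1) that by (rule subsetD)
    moreover have "m \<in> U \<inter> \<M>" if "m \<in> \<M>" "x \<subseteq> m" for m
      using bspec[OF bspec[OF U(2) \<open>x \<in> U\<close>] maximal_proper[OF that(1)]] that by simp
    ultimately show ?thesis
      by (simp add: reg_of_def)
  qed
  ultimately have "U = reg_of (U \<inter> \<M>)"
    by (intro equalityI subsetI)
  then show "U \<in> reg_of ` Pow \<M>"
    by (rule image_eqI) simp
qed

lemma regular_opens_representation: "powerset_representation \<R> \<M> reg_of"
proof
  have "inj_on reg_of (Pow \<M>)"
    by (rule inj_onI) (metis PowD reg_of_subset_iff subset_antisym subset_refl)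
  then show "bij_betw reg_of (Pow \<M>) (carrier \<R>)"
    by (simp add: bij_betw_def carrier_regular_opens)
qed (simp_all add: regular_opens_def Let_def reg_of_subset_iff)

lemmas \<R>_inf_image = powerset_representation.inf_image[OF regular_opens_representation]
  and \<R>_sup_image = powerset_representation.sup_image[OF regular_opens_representation]
  and \<R>_compl = powerset_representation.compl[OF regular_opens_representation]
  and \<R>_bij = powerset_representation.bij[OF regular_opens_representation]
  and \<R>_le_iff = powerset_representation.le_iff[OF regular_opens_representation]
  and \<R>_eq_is_eq = powerset_representation.eq_is_eq[OF regular_opens_representation]

text \<open>At a maximal filter the test "\<open>b\<close> meets every member" is membership of
  \<open>b\<close>. It suffices to test maximal extensions, since the members of a filter
  \<open>y\<close> remain members of any maximal filter above \<open>y\<close>.\<close>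

lemma filter_sigma_eq_reg_of:
  assumes b: "b \<in> B"
  shows "filter_sigma (powerset_mt X) B b = reg_of {m \<in> \<M>. b \<in> m}"
proof -
  have disjoint: "meet (powerset_mt X) b a \<noteq> bottom (powerset_mt X) \<longleftrightarrow> b \<inter> a \<noteq> {}"
    if "y \<in> \<P>" "a \<in> y" for y a
  proof -
    have "a \<in> B"
      using proper_filtersD(1)[OF that(1)] that(2) by (rule subsetD)
    then show ?thesis
      using b by (simp add: powerset_mt_meet powerset_mt_bottom subsets)
  qed
  have "(\<forall>y\<in>\<P>. x \<subseteq> y \<longrightarrow> (\<forall>a\<in>y. b \<inter> a \<noteq> {})) \<longleftrightarrow> (\<forall>m\<in>\<M>. x \<subseteq> m \<longrightarrow> b \<in> m)" if "x \<in> \<P>" for x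
  proof
    assume "\<forall>y\<in>\<P>. x \<subseteq> y \<longrightarrow> (\<forall>a\<in>y. b \<inter> a \<noteq> {})"
    then show "\<forall>m\<in>\<M>. x \<subseteq> m \<longrightarrow> b \<in> m"
      using mem_maximal_iff b maximal_proper by metis
  next
    assume *: "\<forall>m\<in>\<M>. x \<subseteq> m \<longrightarrow> b \<in> m"
    show "\<forall>y\<in>\<P>. x \<subseteq> y \<longrightarrow> (\<forall>a\<in>y. b \<inter> a \<noteq> {})"
    proof (intro ballI impI)
      fix y a assume y: "y \<in> \<P>" "x \<subseteq> y" "a \<in> y"
      obtain m where "m \<in> \<M>" "y \<subseteq> m"
        using extend_maximal y(1) by metis
      then show "b \<inter> a \<noteq> {}"
        using * y mem_maximal_iff[OF _ b] by blast
    qed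
  qed
  then show ?thesis
    unfolding filter_sigma_def reg_of_def using disjoint by (simp cong: conj_cong ball_cong)
qed

section \<open>The topology of the maximal filters and the MT-structure of the regular open
  sets\<close>

definition maximal_space :: "'a set set topology" where
  "maximal_space = topology (arbitrary union_of (\<lambda>U. \<exists>Z\<in>B. U = \<M> - {F \<in> \<M>. Z \<in> F}))"

lemma openin_maximal_space: "openin maximal_space U \<longleftrightarrow> (\<exists>S\<subseteq>B. U = {m \<in> \<M>. \<not> S \<subseteq> m})"
proof -
  have "istopology (arbitrary union_of (\<lambda>U. \<exists>Z\<in>B. U = \<M> - {F \<in> \<M>. Z \<in> F}))"
  proof (rule istopology_base)
    fix V W assume "\<exists>Z\<in>B. V = \<M> - {F \<in> \<M>. Z \<in> F}" "\<exists>Z\<in>B. W = \<M> - {F \<in> \<M>. Z \<in> F}"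
    then obtain Z Z' where Z: "Z \<in> B" "Z' \<in> B"
      and VW: "V = \<M> - {F \<in> \<M>. Z \<in> F}" "W = \<M> - {F \<in> \<M>. Z' \<in> F}"
      by blast
    \<comment> \<open>By primeness a maximal filter omits the union exactly if it omits both
      sets.\<close>
    have "V \<inter> W = \<M> - {F \<in> \<M>. Z \<union> Z' \<in> F}"
      unfolding VW using maximal_prime[OF _ Z] by blast
    then show "\<exists>Z\<in>B. V \<inter> W = \<M> - {F \<in> \<M>. Z \<in> F}"
      using Un_mem[OF Z] by blast
  qed
  then show ?thesis
    by (simp add: maximal_space_def topology_inverse' arbitrary_union_of_separated)
qed

lemma topspace_maximal_space [simp]: "topspace maximal_space = \<M>"
proof
  \<comment> \<open>No proper filter contains the empty set, so the basic open set for
    \<open>{}\<close> is the whole space.\<close>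
  have "\<M> = {m \<in> \<M>. \<not> {{}} \<subseteq> m}"
    using maximal_proper proper_filtersD(2) by blast
  then have "openin maximal_space \<M>"
    unfolding openin_maximal_space by (intro exI[of _ "{{}}"]) simp
  then show "\<M> \<subseteq> topspace maximal_space"
    by (rule openin_subset)
  show "topspace maximal_space \<subseteq> \<M>"
    using openin_topspace[of maximal_space] unfolding openin_maximal_space by blast
qed

text \<open>Meets of regular open sets are intersections on the level of maximal filters, so the
  conditions \<open>b \<in> m\<close> for \<open>b\<close> in \<open>S\<close> combine into
  \<open>S \<subseteq> m\<close>.\<close>

lemma ro_closeds: "ro_closeds (powerset_mt X) B = (\<lambda>S. reg_of {m \<in> \<M>. S \<subseteq> m}) ` Pow B"
proof -
  have "Lattice.inf \<R> (filter_sigma (powerset_mt X) B ` S) = reg_of {m \<in> \<M>. S \<subseteq> m}" if "S \<subseteq> B" for S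
  proof -
    have "filter_sigma (powerset_mt X) B ` S = reg_of ` (\<lambda>b. {m \<in> \<M>. b \<in> m}) ` S"
      unfolding image_image using that by (intro image_cong refl filter_sigma_eq_reg_of) (rule subsetD)
    moreover have "\<M> \<inter> \<Inter>((\<lambda>b. {m \<in> \<M>. b \<in> m}) ` S) = {m \<in> \<M>. S \<subseteq> m}"
      by (simp add: set_eq_iff subset_iff) metis
    moreover have "(\<lambda>b. {m \<in> \<M>. b \<in> m}) ` S \<subseteq> Pow \<M>"
      by (intro image_subsetI PowI Collect_restrict)
    ultimately show ?thesis
      by (simp only: \<R>_inf_image)
  qed
  then show ?thesis
    unfolding ro_closeds_def image_def by (metis (no_types, lifting) PowD PowI)
qed

lemma ro_opens: "ro_opens (powerset_mt X) B = reg_of ` {U. openin maximal_space U}"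
proof -
  have "\<M> - {m \<in> \<M>. S \<subseteq> m} = {m \<in> \<M>. \<not> S \<subseteq> m}" for S
    by (simp add: set_eq_iff) metis
  then have "bcompl \<R> (reg_of {m \<in> \<M>. S \<subseteq> m}) = reg_of {m \<in> \<M>. \<not> S \<subseteq> m}" for S
    using \<R>_compl[of "{m \<in> \<M>. S \<subseteq> m}"] by simp
  then have "ro_opens (powerset_mt X) B = reg_of ` (\<lambda>S. {m \<in> \<M>. \<not> S \<subseteq> m}) ` Pow B"
    by (simp add: ro_opens_def ro_closeds image_image)
  also have "(\<lambda>S. {m \<in> \<M>. \<not> S \<subseteq> m}) ` Pow B = {U. openin maximal_space U}"
    by (simp add: set_eq_iff image_iff openin_maximal_space Bex_def)
  finally show ?thesis .
qed

lemma ro_mt_representation: "space_representation (ro_mt (powerset_mt X) B) maximal_space reg_of"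
proof -
  have ro_mt: "carrier (ro_mt (powerset_mt X) B) = carrier \<R>" "le (ro_mt (powerset_mt X) B) = le \<R>"
    "eq (ro_mt (powerset_mt X) B) = eq \<R>"
    "mt_box (ro_mt (powerset_mt X) B) A = Lattice.sup \<R> {U \<in> ro_opens (powerset_mt X) B. U \<subseteq> A}" for A
    by (simp_all add: ro_mt_def gorder.defs mt.defs)
  show ?thesis
  proof
    fix A assume A: "A \<subseteq> topspace maximal_space"
    let ?\<U> = "{U. openin maximal_space U \<and> U \<subseteq> A}"
    have sub: "U \<subseteq> \<M>" if "openin maximal_space U" for U
      using openin_subset[OF that] by simp
    \<comment> \<open>The open elements below \<open>reg_of A\<close> come from the open sets inside
      \<open>A\<close>; their join comes from the union of these sets, the interior of
      \<open>A\<close>.\<close>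
    then have "{U \<in> ro_opens (powerset_mt X) B. U \<subseteq> reg_of A} = reg_of ` ?\<U>"
      unfolding ro_opens Compr_image_eq by (simp add: reg_of_subset_iff cong: conj_cong)
    moreover have "?\<U> \<subseteq> Pow \<M>"
      by (rule subsetI) (simp add: sub)
    moreover have "\<Union>?\<U> = maximal_space interior_of A"
      unfolding interior_of_def by blast
    ultimately show "mt_box (ro_mt (powerset_mt X) B) (reg_of A) = reg_of (maximal_space interior_of A)"
      by (simp only: ro_mt \<R>_sup_image)
  qed (simp_all add: ro_mt \<R>_bij \<R>_le_iff \<R>_eq_is_eq)
qed

end

section \<open>Zero-elements of a powerset algebra\<close>

lemma mt_closeds_powerset: "mt_closeds (powerset_mt X) = {A. closedin X A}"
proof -
  have "A \<in> mt_closeds (powerset_mt X) \<longleftrightarrow> A \<subseteq> topspace X \<and> A = X closure_of A" for A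
    by (simp add: mt_closeds_def powerset_mt_diamond cong: conj_cong)
  then show ?thesis
    by (metis (no_types, lifting) Collect_cong Collect_mem_eq closedin_subset closure_of_eq)
qed

lemma mt_prec_powerset:
  "\<lbrakk>A \<subseteq> topspace X; C \<subseteq> topspace X\<rbrakk>
    \<Longrightarrow> mt_prec (powerset_mt X) A C \<longleftrightarrow> X closure_of A \<subseteq> X interior_of C"
  by (simp add: mt_prec_def powerset_mt_diamond)

lemma mt_precprec_powerset:
  "mt_precprec (powerset_mt X) A C \<longleftrightarrow> (\<exists>c :: rat \<Rightarrow> 'a set. (\<forall>p\<in>{0..1}. c p \<subseteq> topspace X) \<and>
     A \<subseteq> c 0 \<and> c 1 \<subseteq> C \<and>
     (\<forall>p\<in>{0..1}. \<forall>q\<in>{0..1}. p < q \<longrightarrow> X closure_of c p \<subseteq> X interior_of c q))"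
  unfolding mt_precprec_def powerset_mt_simps Pow_iff
  by (simp add: mt_prec_powerset cong: conj_cong)

text \<open>The indices 0 and 1 of the interpolating family suffice. The inclusion later shows that
  the sequence defining a zero-element is decreasing.\<close>

lemma mt_precprec_powerset_subset:
  assumes "mt_precprec (powerset_mt X) A C"
  shows "A \<subseteq> C"
proof -
  obtain c :: "rat \<Rightarrow> 'a set"
    where c: "\<forall>p\<in>{0..1}. c p \<subseteq> topspace X" "A \<subseteq> c 0" "c 1 \<subseteq> C"
      "\<forall>p\<in>{0..1}. \<forall>q\<in>{0..1}. p < q \<longrightarrow> X closure_of c p \<subseteq> X interior_of c q"
    using assms unfolding mt_precprec_powerset by blast
  have "c 0 \<subseteq> X closure_of c 0"
    using c(1) by (simp add: closure_of_subset)
  also have "\<dots> \<subseteq> X interior_of c 1"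
    using c(4) by simp
  also have "\<dots> \<subseteq> c 1"
    by (rule interior_of_subset)
  finally show ?thesis
    using c(2,3) by blast
qed

text \<open>Treats intersection and union at once by combining the interpolating families pointwise.
  The closure and interior conditions are inclusions because intersection satisfies only an
  inclusion for closures, and union only one for interiors.\<close>

lemma mt_precprec_powerset_binary:
  fixes f :: "'a set \<Rightarrow> 'a set \<Rightarrow> 'a set"
  assumes mono: "\<And>A A' C C'. \<lbrakk>A \<subseteq> A'; C \<subseteq> C'\<rbrakk> \<Longrightarrow> f A C \<subseteq> f A' C'"
    and closed: "\<And>A C. \<lbrakk>A \<subseteq> topspace X; C \<subseteq> topspace X\<rbrakk> \<Longrightarrow> f A C \<subseteq> topspace X"
    and closure: "\<And>A C. X closure_of (f A C) \<subseteq> f (X closure_of A) (X closure_of C)"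
    and interior: "\<And>A C. f (X interior_of A) (X interior_of C) \<subseteq> X interior_of (f A C)"
    and "mt_precprec (powerset_mt X) A A'" "mt_precprec (powerset_mt X) C C'"
  shows "mt_precprec (powerset_mt X) (f A C) (f A' C')"
proof -
  obtain c :: "rat \<Rightarrow> 'a set"
    where c: "\<forall>p\<in>{0..1}. c p \<subseteq> topspace X" "A \<subseteq> c 0" "c 1 \<subseteq> A'"
      "\<forall>p\<in>{0..1}. \<forall>q\<in>{0..1}. p < q \<longrightarrow> X closure_of c p \<subseteq> X interior_of c q"
    using assms(5) unfolding mt_precprec_powerset by blast
  obtain d :: "rat \<Rightarrow> 'a set"
    where d: "\<forall>p\<in>{0..1}. d p \<subseteq> topspace X" "C \<subseteq> d 0" "d 1 \<subseteq> C'"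
      "\<forall>p\<in>{0..1}. \<forall>q\<in>{0..1}. p < q \<longrightarrow> X closure_of d p \<subseteq> X interior_of d q"
    using assms(6) unfolding mt_precprec_powerset by blast
  have "X closure_of (f (c p) (d p)) \<subseteq> X interior_of (f (c q) (d q))"
    if "p \<in> {0..1}" "q \<in> {0..1}" "p < q" for p q
  proof -
    have "X closure_of c p \<subseteq> X interior_of c q" "X closure_of d p \<subseteq> X interior_of d q"
      using c(4) d(4) that by simp_all
    then show ?thesis
      using closure interior mono by (meson order_trans)
  qed
  then show ?thesis
    unfolding mt_precprec_powerset using c d mono closed
    by (intro exI[of _ "\<lambda>p. f (c p) (d p)"]) simp
qed

lemma mt_precprec_powerset_Int:
  assumes "mt_precprec (powerset_mt X) A A'" "mt_precprec (powerset_mt X) C C'"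
  shows "mt_precprec (powerset_mt X) (A \<inter> C) (A' \<inter> C')"
  by (rule mt_precprec_powerset_binary[where f = "(\<inter>)"])
    (use assms in \<open>auto simp: interior_of_Int closure_of_mono
       intro: closure_of_mono[THEN subsetD]\<close>)

lemma mt_precprec_powerset_Un:
  assumes "mt_precprec (powerset_mt X) A A'" "mt_precprec (powerset_mt X) C C'"
  shows "mt_precprec (powerset_mt X) (A \<union> C) (A' \<union> C')"
  by (rule mt_precprec_powerset_binary[where f = "(\<union>)"])
    (use assms in \<open>auto simp: closure_of_Un intro: interior_of_mono[THEN subsetD]\<close>)

lemma zero_elements_powerset:
  "a \<in> zero_elements (powerset_mt X) \<longleftrightarrow> (\<exists>c. (\<forall>n::nat. closedin X (c n)) \<and>
     a = (\<Inter>n. c n) \<and> (\<forall>n. mt_precprec (powerset_mt X) (c (Suc n)) (c n)))"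
proof -
  \<comment> \<open>The family is nonempty and consists of subsets of the space, so intersecting
    with the space changes nothing.\<close>
  have "Lattice.inf (powerset_mt X) (range c) = (\<Inter>n. c n)" if "\<And>n::nat. closedin X (c n)" for c
  proof -
    have "c n \<subseteq> topspace X" for n
      using that by (rule closedin_subset)
    then have "range c \<subseteq> Pow (topspace X)" "topspace X \<inter> (\<Inter>n. c n) = (\<Inter>n. c n)"
      by blast+
    then show ?thesis
      using powerset_mt_inf[of "range c" X] by simp
  qed
  then show ?thesis
    by (simp add: zero_elements_def mt_closeds_powerset cong: conj_cong)
qed

text \<open>A clopen set equals its closure and its interior, so constant families serve both as
  interpolation and as defining sequence. This supplies the two bounds of the lattice.\<close>

lemma zero_elements_const:
  assumes "closedin X A" "openin X A"
  shows "A \<in> zero_elements (powerset_mt X)"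
proof -
  have "mt_precprec (powerset_mt X) A A"
    unfolding mt_precprec_def using assms
    by (intro exI[of _ "\<lambda>_. A"])
      (simp add: mt_prec_powerset closedin_subset closure_of_closedin interior_of_openin)
  then show ?thesis
    unfolding zero_elements_powerset using assms by (intro exI[of _ "\<lambda>_. A"]) simp
qed

lemma set_lattice_zero_elements: "set_lattice X (zero_elements (powerset_mt X))"
proof (rule set_lattice.intro)
  show "A \<subseteq> topspace X" if "A \<in> zero_elements (powerset_mt X)" for A
  proof -
    from that[unfolded zero_elements_powerset]
    obtain c :: "nat \<Rightarrow> 'a set" where "\<forall>n. closedin X (c n)" "A = (\<Inter>n. c n)"
      by (elim exE conjE)
    then have "A \<subseteq> c 0" "c 0 \<subseteq> topspace X"
      by (simp_all add: INT_lower closedin_subset)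
    then show ?thesis
      by (rule order_trans)
  qed
  show "{} \<in> zero_elements (powerset_mt X)" "topspace X \<in> zero_elements (powerset_mt X)"
    by (simp_all add: zero_elements_const)
next
  fix A C
  assume A: "A \<in> zero_elements (powerset_mt X)" and C: "C \<in> zero_elements (powerset_mt X)"
  from A[unfolded zero_elements_powerset]
  obtain c :: "nat \<Rightarrow> 'a set" where c: "\<forall>n. closedin X (c n)" "A = (\<Inter>n. c n)"
      "\<forall>n. mt_precprec (powerset_mt X) (c (Suc n)) (c n)"
    by (elim exE conjE)
  from C[unfolded zero_elements_powerset]
  obtain d :: "nat \<Rightarrow> 'a set" where d: "\<forall>n. closedin X (d n)" "C = (\<Inter>n. d n)"
      "\<forall>n. mt_precprec (powerset_mt X) (d (Suc n)) (d n)"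
    by (elim exE conjE)
  have "A \<inter> C = (\<Inter>n. c n \<inter> d n)"
    unfolding c(2) d(2) by blast
  then show "A \<inter> C \<in> zero_elements (powerset_mt X)"
    unfolding zero_elements_powerset using c(1,3) d(1,3)
    by (intro exI[of _ "\<lambda>n. c n \<inter> d n"]) (simp add: closedin_Int mt_precprec_powerset_Int)
  have "c (Suc n) \<subseteq> c n" "d (Suc n) \<subseteq> d n" for n
    using mt_precprec_powerset_subset[OF spec[OF c(3)]] mt_precprec_powerset_subset[OF spec[OF d(3)]] .
  then have anti: "c n \<subseteq> c m" "d n \<subseteq> d m" if "m \<le> n" for m n
    using that by (simp_all add: lift_Suc_antimono_le[of c] lift_Suc_antimono_le[of d])
  \<comment> \<open>This inclusion needs decreasing sequences: a point outside \<open>c i\<close>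
    and outside \<open>d j\<close> lies outside both sets at index \<open>max i j\<close>.\<close>
  have "(\<Inter>n. c n \<union> d n) \<subseteq> A \<union> C"
  proof
    fix x assume x: "x \<in> (\<Inter>n. c n \<union> d n)"
    show "x \<in> A \<union> C"
    proof (rule ccontr)
      assume "x \<notin> A \<union> C"
      then obtain i j where "x \<notin> c i" "x \<notin> d j"
        unfolding c(2) d(2) by blast
      then have "x \<notin> c (max i j)" "x \<notin> d (max i j)"
        using anti by (meson max.cobounded1 max.cobounded2 subsetD)+
      then show False
        using x by blast
    qed
  qed
  then have "A \<union> C = (\<Inter>n. c n \<union> d n)"
    unfolding c(2) d(2) by blast
  then show "A \<union> C \<in> zero_elements (powerset_mt X)"
    unfolding zero_elements_powerset using c(1,3) d(1,3)
    by (intro exI[of _ "\<lambda>n. c n \<union> d n"]) (simp add: closedin_Un mt_precprec_powerset_Un)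
qed

theorem theorem4p27:
  fixes X :: "'a topology"
  assumes "completely_regular_space X" and "t1_space X"
  shows "powerset_mt (stone_cech X) \<cong>\<^sub>M\<^sub>T mt_beta (powerset_mt X) \<and>
    stone_cech X homeomorphic_space atom_space (mt_beta (powerset_mt X))"
proof -
  interpret set_lattice X "zero_elements (powerset_mt X)"
    by (rule set_lattice_zero_elements)
  \<comment> \<open>For the lattice of zero-elements, \<open>maximal_space\<close> unfolds to
    \<open>stone_cech X\<close>. The powerset algebra of this space is represented by the identity
    and \<open>mt_beta\<close> by \<open>reg_of\<close>, so both conclusions follow from the general
    results on representations.\<close>
  have rep: "space_representation (mt_beta (powerset_mt X)) (stone_cech X) reg_of"
    using ro_mt_representation by (simp add: mt_beta_def stone_cech_def maximal_space_def)
  show ?thesis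
    using mt_isomorphic_representations[OF powerset_mt_representation rep]
      space_representation.homeomorphic_atom_space[OF rep] by blast
qed

end
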